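(* For every $0<\alpha<1$ there are constants $0<c_\alpha\le C_\alpha<\infty$ depending only on $\alpha$ such that for every odd $n\ge3$, with $A_n=\{x\in\{-1,1\}^n:\sum_{i=1}^n x_i>0\}$, $$c_\alpha\,\mathbb E\,\omega_\alpha(h_{A_n}(x))\ \le\ \sum_{S\ne\varnothing}|S|^\alpha\,\widehat{\mathbf 1_{A_n}}(S)^2\ \le\ C_\alpha\,\mathbb E\,\omega_\alpha(h_{A_n}(x)).$$ Consequently the inequality $\sum_{S\ne\varnothing}\sqrt{|S|}\,\widehat{\mathbf 1_A}(S)^2\lesssim\mathbb E[\sqrt{h_A(x)}\log(e+h_A(x))]$ (for $A\subset\{-1,1\}^n$) is sharp up to universal constants: for $A=A_n$ its two sides are comparable up to universal constants.
   Context: $\{-1,1\}^n$ carries the uniform probability measure, with expectation $\mathbb E$. For $S\subseteq[n]=\{1,\dots,n\}$, $\chi_S(x)=\prod_{i\in S}x_i$ and $\widehat g(S)=\mathbb E[g\chi_S]$. $x^{\oplus i}$ is $x$ with the $i$th coordinate flipped. $\mathbf 1_A$ is the indicator of $A$, and $h_A(x)=\#\{i\in[n]: x\in A,\ x^{\oplus i}\notin A\}$. The function $\omega_\alpha$ on nonnegative integers is defined by $\omega_\alpha(0)=0$ and, for $m\ge1$: $\omega_\alpha(m)=\sqrt m$ if $0<\alpha<1/2$; $\omega_{1/2}(m)=\sqrt m\log(e+m)$; $\omega_\alpha(m)=m^\alpha$ if $1/2<\alpha<1$. The notation $a\lesssim b$ means $a\le Cb$ for a universal constant $C$. *)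

theory Defs
  imports "HOL-Probability.Probability"
begin

(* Points of {-1,1}^n are functions on {1..n}, extended by the value undefined
   outside {1..n}, so that the cube is a finite set with 2^n elements. *)
definition cube :: "nat \<Rightarrow> (nat \<Rightarrow> real) set" where
  "cube n = (\<Pi>\<^sub>E i\<in>{1..n}. {-1, 1})"

definition cube_expectation :: "nat \<Rightarrow> ((nat \<Rightarrow> real) \<Rightarrow> real) \<Rightarrow> real" where
  "cube_expectation n g = measure_pmf.expectation (pmf_of_set (cube n)) g"

definition walsh :: "nat set \<Rightarrow> (nat \<Rightarrow> real) \<Rightarrow> real" where
  "walsh S x = (\<Prod>i\<in>S. x i)"

definition fourier_coeff :: "nat \<Rightarrow> ((nat \<Rightarrow> real) \<Rightarrow> real) \<Rightarrow> nat set \<Rightarrow> real" where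
  "fourier_coeff n g S = cube_expectation n (\<lambda>x. g x * walsh S x)"

definition flip_coord :: "(nat \<Rightarrow> real) \<Rightarrow> nat \<Rightarrow> nat \<Rightarrow> real" where
  "flip_coord x i = x(i := - x i)"

definition sens :: "nat \<Rightarrow> (nat \<Rightarrow> real) set \<Rightarrow> (nat \<Rightarrow> real) \<Rightarrow> nat" where
  "sens n A x = card {i \<in> {1..n}. x \<in> A \<and> flip_coord x i \<notin> A}"

(* Only meaningful for 0 < \<alpha> < 1. *)
definition omega :: "real \<Rightarrow> nat \<Rightarrow> real" where
  "omega \<alpha> m =
     (if m = 0 then 0
      else if \<alpha> < 1 / 2 then sqrt (real m)
      else if \<alpha> = 1 / 2 then sqrt (real m) * ln (exp 1 + real m)
      else real m powr \<alpha>)"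

definition majority_set :: "nat \<Rightarrow> (nat \<Rightarrow> real) set" where
  "majority_set n = {x \<in> cube n. (\<Sum>i=1..n. x i) > 0}"

end

theory Submission
  imports Defs
begin

text \<open>
  Write $n = 2m+1$ and let $p_j = \binom{2j}{j}/4^j$, the probability that $2j$ fair signs sum to
  zero.  Both sides of the comparison have closed forms in the $p_j$.

  A point of the majority set has a neighbour outside it only when its coordinate sum is $1$, and
  then exactly its $m+1$ positive coordinates are sensitive.  The expectation is therefore
  $\omega_\alpha(m+1)$ times the probability $\frac{2m+1}{2m+2}\,p_m$ of that single layer
  (lemma \<open>expectation_sens_majority\<close>).

  On the Fourier side, the generating polynomial
  $\sum_x \chi_S(x) z^{\#\{i : x_i = 1\}} = (z-1)^{|S|}(z+1)^{n-|S|}$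
  gives every coefficient.  Summing its upper half telescopes, because one factor $z-1$ can be split
  off, and leaves the middle coefficient $r_t$ of $(z-1)^t(z+1)^{2m-t}$ for $t = |S|-1$.
  These middle coefficients obey a two-step recurrence.  It makes those with odd $t$ vanish and
  evaluates the others, so that the weight of the Fourier spectrum on level $2j+1$ is
  $\frac{2m+1}{4(2j+1)}\,p_m\,p_j\,p_{m-j}$ (lemma \<open>fourier_energy_majority\<close>).

  The factor $p_m$ cancels.  What remains is a one-variable estimate: as $p_j$ has order $j^{-1/2}$,
  the energy is, up to the same normalisation, $M = m+1$ times the convolution of
  $i^{\alpha-3/2}$ with $i^{-1/2}$ over $i \le M$.  The convolution is comparable to
  $M^{-1/2}\sum_{i\le M} i^{\alpha-3/2}$: its half $i \le M/2$ has this form, and its half $i > M/2$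
  has order at most $M^{\alpha-1}$, which is $M$ times the last summand of that expression.  Finally $\sqrt M \sum_{i\le M} i^{\alpha-3/2}$ is
  comparable to $\omega_\alpha(M)$: the three cases in the definition of $\omega_\alpha$ are the
  convergent, the logarithmic and the divergent regime of this sum.
\<close>

section \<open>Layers of the cube and their character sums\<close>

definition plus_count :: "nat \<Rightarrow> (nat \<Rightarrow> real) \<Rightarrow> nat" where
  "plus_count n x = card {i \<in> {1..n}. x i = 1}"

lemma finite_cube: "finite (cube n)"
  by (simp add: cube_def finite_PiE)

lemma card_cube: "card (cube n) = 2 ^ n"
  by (simp add: cube_def card_PiE numeral_2_eq_2)

lemma cube_expectation_eq: "cube_expectation n g = (\<Sum>x\<in>cube n. g x) / 2 ^ n"
proof -
  have "cube n \<noteq> {}"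
    using card_cube[of n] by auto
  then show ?thesis
    unfolding cube_expectation_def
    by (subst integral_pmf_of_set) (simp_all add: finite_cube card_cube)
qed

lemma cube_coord:
  assumes "x \<in> cube n" "i \<in> {1..n}"
  shows "x i = -1 \<or> x i = 1"
  using PiE_mem[of x "{1..n}" "\<lambda>_. {-1, 1}" i] assms unfolding cube_def by auto

lemma sum_coords_cube:
  assumes "x \<in> cube n"
  shows "(\<Sum>i=1..n. x i) = 2 * real (plus_count n x) - real n"
proof -
  have "(\<Sum>i=1..n. x i) = (\<Sum>i=1..n. 2 * (if x i = 1 then 1 else 0) - 1)"
    using cube_coord[OF assms] by (intro sum.cong) auto
  also have "\<dots> = 2 * (\<Sum>i=1..n. if x i = 1 then 1 else 0) - real n"
    by (simp add: sum_subtractf sum_distrib_left)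
  also have "(\<Sum>i=1..n. if x i = 1 then 1 else (0::real)) = real (plus_count n x)"
    unfolding plus_count_def by (simp add: sum.If_cases Int_def)
  finally show ?thesis .
qed

text \<open>
  Both the character and the monomial are products over the coordinates, so the sum over the cube
  factorises: a coordinate contributes $z - 1$ if it lies in $S$ and $z + 1$ otherwise.
\<close>
lemma walsh_generating_polynomial:
  assumes S: "S \<subseteq> {1..n}"
  shows "(\<Sum>x\<in>cube n. smult (walsh S x) (monom 1 (plus_count n x)))
           = [:-1, 1:] ^ card S * [:1, 1:] ^ (n - card S)"
proof -
  define g :: "nat \<Rightarrow> real \<Rightarrow> real poly" where
    "g i v = smult (if i \<in> S then v else 1) (if v = 1 then [:0, 1:] else 1)" for i v
  have prod_smult': "(\<Prod>i\<in>A. smult (c i) (q i)) = smult (\<Prod>i\<in>A. c i) (\<Prod>i\<in>A. q i)"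
    for A :: "nat set" and c :: "nat \<Rightarrow> real" and q
    by (induction A rule: infinite_finite_induct) (auto simp: mult.commute)
  have factor: "smult (walsh S x) (monom 1 (plus_count n x)) = (\<Prod>i\<in>{1..n}. g i (x i))" for x
  proof -
    have "(\<Prod>i\<in>{1..n}. if i \<in> S then x i else 1) = walsh S x"
      unfolding walsh_def using S by (intro prod.mono_neutral_cong_right) auto
    moreover have "(\<Prod>i\<in>{1..n}. if x i = 1 then [:0, 1:] else 1)
                     = (monom 1 (plus_count n x) :: real poly)"
      unfolding plus_count_def
      by (simp add: prod.If_cases Int_def monom_altdef)
    ultimately show ?thesis
      unfolding g_def prod_smult' by simp
  qed
  have "(\<Sum>x\<in>cube n. smult (walsh S x) (monom 1 (plus_count n x)))
          = (\<Sum>x\<in>cube n. \<Prod>i\<in>{1..n}. g i (x i))"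
    by (simp add: factor)
  also have "\<dots> = (\<Prod>i\<in>{1..n}. \<Sum>v\<in>{-1, 1}. g i v)"
    unfolding cube_def by (rule prod_sum_PiE[symmetric]) auto
  also have "\<dots> = (\<Prod>i\<in>{1..n}. if i \<in> S then [:-1, 1:] else [:1, 1:])"
    by (intro prod.cong) (auto simp: g_def one_pCons)
  also have "\<dots> = [:-1, 1:] ^ card S * [:1, 1:] ^ card ({1..n} - S)"
    using S by (simp add: prod.If_cases Int_absorb1 Diff_eq)
  also have "card ({1..n} - S) = n - card S"
    using S by (simp add: card_Diff_subset finite_subset)
  finally show ?thesis .
qed

lemma layer_sum:
  assumes "S \<subseteq> {1..n}"
  shows "(\<Sum>x | x \<in> cube n \<and> plus_count n x = l. walsh S x)
           = coeff ([:-1, 1:] ^ card S * [:1, 1:] ^ (n - card S)) l"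
proof -
  have "coeff ([:-1, 1:] ^ card S * [:1, 1:] ^ (n - card S)) l
          = (\<Sum>x\<in>cube n. if plus_count n x = l then walsh S x else 0)"
    unfolding walsh_generating_polynomial[OF assms, symmetric] coeff_sum
    by (intro sum.cong) auto
  then show ?thesis
    by (simp add: sum.If_cases finite_cube Int_def)
qed

lemma card_layer: "card {x \<in> cube n. plus_count n x = l} = n choose l"
proof -
  have "real (card {x \<in> cube n. plus_count n x = l}) = coeff ([:1, 1:] ^ n) l"
    using layer_sum[of "{}" n l] by (simp add: walsh_def)
  also have "\<dots> = real (n choose l)"
    by (cases "l \<le> n")
      (simp_all add: coeff_linear_poly_power coeff_eq_0 degree_linear_power binomial_eq_0)
  finally show ?thesis by simp
qed

section \<open>Sensitivity of majority\<close>

lemma in_majority_set_iff: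
  assumes "x \<in> cube (2 * m + 1)"
  shows "x \<in> majority_set (2 * m + 1) \<longleftrightarrow> m < plus_count (2 * m + 1) x"
proof -
  have "(\<Sum>i=1..2 * m + 1. x i) > 0 \<longleftrightarrow> m < plus_count (2 * m + 1) x"
    unfolding sum_coords_cube[OF assms] by linarith
  then show ?thesis
    using assms by (simp add: majority_set_def)
qed

text \<open>
  Flipping $x_i$ changes the coordinate sum by $2x_i$, and the sum is odd.  A positive sum can thus
  become negative only if it equals $1$ and the flipped coordinate is positive.
\<close>
lemma sens_majority:
  assumes x: "x \<in> cube (2 * m + 1)"
  shows "sens (2 * m + 1) (majority_set (2 * m + 1)) x
           = (if plus_count (2 * m + 1) x = m + 1 then m + 1 else 0)"
proof -
  let ?n = "2 * m + 1" and ?A = "majority_set (2 * m + 1)"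
  have pivotal: "x \<in> ?A \<and> flip_coord x i \<notin> ?A \<longleftrightarrow> plus_count ?n x = m + 1 \<and> x i = 1"
    if i: "i \<in> {1..?n}" for i
  proof -
    have fc: "flip_coord x i \<in> cube ?n"
      using x i cube_coord[OF x i] unfolding cube_def flip_coord_def
      by (auto simp: PiE_iff extensional_def)
    have "(\<Sum>j=1..?n. flip_coord x i j) = (\<Sum>j=1..?n. x j - (if j = i then 2 * x i else 0))"
      by (intro sum.cong) (auto simp: flip_coord_def)
    also have "\<dots> = (\<Sum>j=1..?n. x j) - 2 * x i"
      using i by (simp add: sum_subtractf)
    finally have "flip_coord x i \<in> ?A \<longleftrightarrow> (\<Sum>j=1..?n. x j) - 2 * x i > 0"
      using fc by (simp add: majority_set_def)
    then have *: "flip_coord x i \<in> ?A \<longleftrightarrow> 2 * real (plus_count ?n x) - real ?n - 2 * x i > 0"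
      unfolding sum_coords_cube[OF x] .
    show ?thesis
      unfolding * in_majority_set_iff[OF x] using cube_coord[OF x i] by auto
  qed
  have "{i \<in> {1..?n}. x \<in> ?A \<and> flip_coord x i \<notin> ?A}
          = (if plus_count ?n x = m + 1 then {i \<in> {1..?n}. x i = 1} else {})"
    using pivotal by auto
  then show ?thesis
    unfolding sens_def by (simp add: plus_count_def)
qed

definition central_prob :: "nat \<Rightarrow> real" where
  "central_prob j = real ((2 * j) choose j) / 4 ^ j"

lemma central_prob_pos: "central_prob j > 0"
  by (simp add: central_prob_def)

lemma central_prob_0 [simp]: "central_prob 0 = 1"
  by (simp add: central_prob_def)

lemma binomial_Suc_ratio: "real (Suc k) * real (n choose Suc k) = real (n - k) * real (n choose k)"
  using binomial_absorption[of k n] binomial_absorb_comp[of n k]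
  by (metis of_nat_mult)

lemma central_prob_Suc:
  "central_prob (Suc j) = central_prob j * (2 * real j + 1) / (2 * real j + 2)"
proof -
  have "real (Suc j) * real (2 * Suc j choose Suc j) = real (2 * Suc j) * real (Suc (2 * j) choose j)"
    using Suc_times_binomial[of j "Suc (2 * j)"]
    by (metis mult_2_right mult_Suc_right add_Suc of_nat_mult mult_2 add_Suc_right)
  moreover have "Suc (2 * j) choose j = Suc (2 * j) choose Suc j"
    using binomial_symmetric[of j "Suc (2 * j)"] by (simp del: binomial_Suc_Suc)
  moreover have "real (Suc j) * real (Suc (2 * j) choose Suc j) = real (Suc (2 * j)) * real (2 * j choose j)"
    using Suc_times_binomial[of j "2 * j"] by (metis of_nat_mult)
  ultimately have "real (2 * Suc j choose Suc j) * (real j + 1)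
      = 2 * (2 * real j + 1) * real (2 * j choose j)"
    by (simp add: algebra_simps del: binomial_Suc_Suc)
  then have "real (2 * Suc j choose Suc j) = 4 * ((2 * real j + 1) * real (2 * j choose j) / (2 * real j + 2))"
    by (simp add: field_simps del: binomial_Suc_Suc)
  then show ?thesis
    unfolding central_prob_def by (simp add: mult.commute del: binomial_Suc_Suc)
qed

text \<open>
  Here $\binom{2m+1}{m+1}$ is expressed through the central binomial coefficient so that the factor
  $p_m$ is visible; the same factor appears in the Fourier energy.
\<close>
lemma expectation_sens_majority:
  assumes "F 0 = 0"
  shows "cube_expectation (2 * m + 1)
            (\<lambda>x. F (sens (2 * m + 1) (majority_set (2 * m + 1)) x))
         = (2 * real m + 1) / (2 * real m + 2) * central_prob m * F (m + 1)"
proof -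
  let ?n = "2 * m + 1"
  have "(\<Sum>x\<in>cube ?n. F (sens ?n (majority_set ?n) x))
          = (\<Sum>x\<in>cube ?n. if plus_count ?n x = m + 1 then F (m + 1) else 0)"
    using assms by (intro sum.cong) (auto simp: sens_majority simp del: One_nat_def)
  also have "\<dots> = real (?n choose (m + 1)) * F (m + 1)"
    using card_layer[of ?n "m + 1"] by (simp add: sum.If_cases finite_cube Int_def)
  finally have *: "cube_expectation ?n (\<lambda>x. F (sens ?n (majority_set ?n) x))
     = real (?n choose (m + 1)) * F (m + 1) / 2 ^ ?n"
    by (simp add: cube_expectation_eq)
  have "Suc m * (?n choose (m + 1)) = ?n * ((2 * m) choose m)"
    using Suc_times_binomial[of m "2*m"] by simp
  then have "(real m + 1) * real (?n choose (m + 1)) = (2 * real m + 1) * real ((2 * m) choose m)"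
    by (metis (no_types, opaque_lifting) Suc_eq_plus1 of_nat_Suc of_nat_mult of_nat_numeral add.commute)
  then have "real (?n choose (m + 1)) = 2 * ((2 * real m + 1) * real ((2 * m) choose m) / (2 * real m + 2))"
    by (simp add: field_simps del: binomial_Suc_Suc)
  then show ?thesis
    unfolding * central_prob_def by (simp add: power_mult del: binomial_Suc_Suc)
qed

section \<open>Fourier coefficients of majority\<close>

text \<open>
  This is, up to sign, the value at $t$ of the Krawtchouk polynomial of degree $m$ for the cube of
  dimension $2m$.  It is meant for $t \le 2m$.
\<close>
definition central_coeff :: "nat \<Rightarrow> nat \<Rightarrow> real" where
  "central_coeff m t = coeff ([:-1, 1:] ^ t * [:1, 1:] ^ (2 * m - t)) m"

text \<open>
  The coefficient is the sum of $[z^l]\,(z-1)R(z)$ over $l > m$, where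
  $R = (z-1)^{|S|-1}(z+1)^{2m+1-|S|}$.  This telescopes to the middle coefficient of $R$.  In terms of
  the cube, it is the passage from majority to its discrete derivative in a direction
  $i \in S$, the indicator of a balanced vector of the other $2m$ signs.
\<close>
lemma fourier_coeff_majority:
  assumes S: "S \<subseteq> {1..2 * m + 1}" and "S \<noteq> {}"
  shows "fourier_coeff (2 * m + 1) (indicator (majority_set (2 * m + 1))) S
           = central_coeff m (card S - 1) / 2 ^ (2 * m + 1)"
proof -
  let ?n = "2 * m + 1"
  have fin: "finite S" using S finite_subset by blast
  then obtain t where t: "card S = Suc t"
    using \<open>S \<noteq> {}\<close> by (metis card_0_eq not0_implies_Suc)
  have tn: "t \<le> 2 * m"
    using card_mono[OF _ S] t by simp
  define R :: "real poly" where "R = [:-1, 1:] ^ t * [:1, 1:] ^ (2 * m - t)"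
  have degR: "degree R \<le> 2 * m"
    unfolding R_def
    by (rule order.trans[OF degree_mult_le]) (use tn in \<open>simp add: degree_linear_power\<close>)
  have poly: "[:-1, 1:] ^ card S * [:1, 1:] ^ (?n - card S) = [:-1, 1:] * R"
    unfolding R_def t by (simp only: power_Suc mult.assoc diff_Suc_Suc add_Suc_right Suc_eq_plus1[symmetric])
  have "(\<Sum>x\<in>cube ?n. indicator (majority_set ?n) x * walsh S x)
          = (\<Sum>x\<in>cube ?n. \<Sum>l\<in>{Suc m..?n}. if plus_count ?n x = l then walsh S x else 0)"
  proof (intro sum.cong refl)
    fix x assume x: "x \<in> cube ?n"
    have "card {i \<in> {1..?n}. x i = 1} \<le> card {1..?n}"
      by (rule card_mono) auto
    then have "plus_count ?n x \<le> ?n"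
      by (simp add: plus_count_def)
    then show "indicator (majority_set ?n) x * walsh S x
          = (\<Sum>l\<in>{Suc m..?n}. if plus_count ?n x = l then walsh S x else 0)"
      using in_majority_set_iff[OF x] by (simp add: indicator_def)
  qed
  also have "\<dots> = (\<Sum>l\<in>{Suc m..?n}. \<Sum>x\<in>cube ?n. if plus_count ?n x = l then walsh S x else 0)"
    by (rule sum.swap)
  also have "\<dots> = (\<Sum>l\<in>{Suc m..?n}. coeff ([:-1, 1:] * R) l)"
    unfolding poly[symmetric] layer_sum[OF S, symmetric]
    by (simp add: sum.If_cases finite_cube Int_def)
  also have "\<dots> = (\<Sum>l\<in>{m..2 * m}. coeff R l - coeff R (Suc l))"
    unfolding Suc_eq_plus1[symmetric] sum.shift_bounds_cl_Suc_ivl by simp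
  also have "\<dots> = coeff R m - coeff R (Suc (2 * m))"
    using sum_Suc_diff[of m "2 * m" "\<lambda>l. - coeff R l"] by simp
  also have "\<dots> = central_coeff m t"
    using degR by (simp add: coeff_eq_0 central_coeff_def R_def)
  finally show ?thesis
    unfolding fourier_coeff_def cube_expectation_eq t by simp
qed

text \<open>
  The operator $U \mapsto 2zU' - 2mU$ multiplies the coefficient of $z^l$ by $2l - 2m$; on the cube it
  is multiplication by the coordinate sum.  Hence it annihilates the middle coefficient.  Applied to
  $U = (z-1)^{t+1}(z+1)^{2m-t-1}$ it produces a combination of the two polynomials
  with exponents $t$ and $t+2$, because $2z = (z-1) + (z+1)$.
\<close>
lemma central_coeff_recurrence:
  assumes "Suc t < 2 * m"
  shows "real (Suc t) * central_coeff m t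
           + real (2 * m - Suc t) * central_coeff m (Suc (Suc t)) = 0"
proof -
  define s where "s = 2 * m - Suc (Suc t)"
  let ?P = "[:-1, 1:] :: real poly" and ?Q = "[:1, 1:] :: real poly"
  define U where "U = ?P ^ Suc t * ?Q ^ Suc s"
  have st: "2 * m - t = Suc (Suc s)" "2 * m - Suc t = Suc s" "2 * m - Suc (Suc t) = s"
    and N: "2 * real m = real t + real s + 2"
    using assms by (auto simp: s_def)
  have linear: "pderiv (?P ^ Suc k) = of_nat (Suc k) * ?P ^ k" "pderiv (?Q ^ Suc k) = of_nat (Suc k) * ?Q ^ k" for k
    by (simp_all add: pderiv_power_Suc pderiv_pCons of_nat_poly del: power_Suc)
  have dU: "pderiv U = of_nat (Suc t) * (?P ^ t * ?Q ^ Suc s) + of_nat (Suc s) * (?P ^ Suc t * ?Q ^ s)"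
    unfolding U_def pderiv_mult linear by (simp only: mult_ac add_ac)
  have ring_identity: "a * (p ^ t * q ^ Suc (Suc s)) + b * (p ^ Suc (Suc t) * q ^ s)
      = (p + q) * (a * (p ^ t * q ^ Suc s) + b * (p ^ Suc t * q ^ s)) - (a + b) * (p ^ Suc t * q ^ Suc s)"
    for a b p q :: "real poly"
    by (simp add: ring_distribs mult_ac)
  \<comment> \<open>Writing both $2z$ and $2m$ as sums turns the claim into the ring identity above.\<close>
  have X1: "2 * [:0, 1:] = ?P + ?Q"
    by (simp add: numeral_poly)
  have X2: "of_nat (2 * m) = of_nat (Suc t) + (of_nat (Suc s) :: real poly)"
    using N unfolding of_nat_add[symmetric] by (metis assms st(2) le_add_diff_inverse less_imp_le_nat)
  have "of_nat (Suc t) * (?P ^ t * ?Q ^ Suc (Suc s)) + of_nat (Suc s) * (?P ^ Suc (Suc t) * ?Q ^ s)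
          = 2 * [:0, 1:] * pderiv U - of_nat (2 * m) * U"
    unfolding dU X1 X2 unfolding U_def by (rule ring_identity)
  then have "coeff (of_nat (Suc t) * (?P ^ t * ?Q ^ Suc (Suc s)) + of_nat (Suc s) * (?P ^ Suc (Suc t) * ?Q ^ s)) m
          = coeff (2 * [:0, 1:] * pderiv U - of_nat (2 * m) * U) m"
    by simp
  also have "\<dots> = 0"
    by (cases m) (simp_all add: of_nat_poly numeral_poly coeff_pderiv algebra_simps)
  finally show ?thesis
    unfolding central_coeff_def st by (simp add: of_nat_poly)
qed

text \<open>
  In the base case $(z-1)(z+1)^{2m-1}$ has middle coefficient
  $\binom{2m-1}{m-1} - \binom{2m-1}{m} = 0$ by symmetry; the recurrence carries the zero upwards.
\<close>
lemma central_coeff_odd: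
  assumes "2 * j + 1 < 2 * m"
  shows "central_coeff m (2 * j + 1) = 0"
  using assms
proof (induction j)
  case 0
  define s where "s = 2 * m - 2"
  let ?Q = "[:1, 1:] :: real poly"
  have s: "2 * m - 1 = Suc s" and m: "Suc s + 1 = 2 * m" using 0 by (auto simp: s_def)
  obtain k where k: "m = Suc k" using 0 by (cases m) auto
  have "central_coeff m 1 = real (Suc s choose k) - real (Suc s choose Suc k)"
    unfolding central_coeff_def s using m k
    by (simp add: coeff_linear_poly_power del: power_Suc binomial_Suc_Suc)
  also have "Suc s choose k = Suc s choose Suc k"
    using m k binomial_symmetric[of k "Suc s"] by (simp del: binomial_Suc_Suc)
  finally show ?case by simp
next
  case (Suc j)
  then show ?case
    using central_coeff_recurrence[of "2 * j + 1" m] by simp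
qed

text \<open>
  Explicitly $r_{2j} = (-1)^j \binom{2m}{m}\binom{m}{j}/\binom{2m}{2j}$, but only its square enters the
  Fourier weight, and after multiplication by the binomial coefficient the square splits into three
  return probabilities.  In this form both sides are multiplied by
  $\frac{(2j+1)(2d+2)}{(2j+2)(2d+1)}$, with $d = m-j-1$, when $j$ increases by one.
\<close>
lemma central_coeff_even:
  assumes "j \<le> m"
  shows "(central_coeff m (2 * j))\<^sup>2 * real ((2 * m) choose (2 * j))
           = 4 ^ (2 * m) * central_prob m * central_prob j * central_prob (m - j)"
  using assms
proof (induction j)
  case 0
  have "central_coeff m 0 = real ((2 * m) choose m)"
    by (simp add: central_coeff_def coeff_linear_poly_power)
  then show ?case
    unfolding central_prob_def mult_2 power_add by (simp add: power2_eq_square)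
next
  case (Suc j)
  define d where "d = m - Suc j"
  have m: "real m = real j + real d + 1" and mj: "m - j = Suc d" "m - Suc j = d"
    using Suc.prems by (auto simp: d_def)
  let ?a = "2 * real j + 1" and ?b = "2 * real d + 1"
  have rec: "?b * central_coeff m (2 * Suc j) = - ?a * central_coeff m (2 * j)"
    using central_coeff_recurrence[of "2 * j" m] Suc.prems
    by (simp add: mj of_nat_diff m algebra_simps)
  have "real (2 * m choose Suc (2 * j)) * ?a = real (2 * m choose (2 * j)) * (?b + 1)"
    using binomial_Suc_ratio[of "2 * j" "2 * m"] Suc.prems
    by (simp add: of_nat_diff m algebra_simps)
  moreover have "real (2 * m choose (2 * Suc j)) * (?a + 1) = real (2 * m choose Suc (2 * j)) * ?b"
    using binomial_Suc_ratio[of "Suc (2 * j)" "2 * m"] Suc.prems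
    by (simp add: of_nat_diff m algebra_simps)
  ultimately have bin: "real (2 * m choose (2 * Suc j)) * ((?a + 1) * ?a)
      = real (2 * m choose (2 * j)) * (?b * (?b + 1))"
    by (simp only: mult.assoc[symmetric]) (simp only: mult_ac)
  have pd: "central_prob (m - j) * (?b + 1) = central_prob d * ?b"
    unfolding mj central_prob_Suc by (simp add: field_simps)
  have pj: "central_prob (Suc j) * (?a + 1) = central_prob j * ?a"
    unfolding central_prob_Suc by (simp add: field_simps)
  have IH: "(central_coeff m (2 * j))\<^sup>2 * real ((2 * m) choose (2 * j))
           = 4 ^ (2 * m) * central_prob m * central_prob j * central_prob (m - j)"
    using Suc by simp
  \<comment> \<open>The induction step with $a = 2j+1$ and $b = 2d+1$: multiply both sides by $b^2(a+1)a$.\<close>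
  have clear_denominators: "x'\<^sup>2 * N' = K * P' * Q'"
    if "b * x' = - a * x" "N' * ((a + 1) * a) = N * (b * (b + 1))" "x\<^sup>2 * N = K * P * Q"
       "Q * (b + 1) = Q' * b" "P' * (a + 1) = P * a" "a > 0" "b > 0"
    for x x' N N' K P P' Q Q' a b :: real
  proof -
    have "(x'\<^sup>2 * N') * (b\<^sup>2 * ((a + 1) * a)) = (b * x')\<^sup>2 * (N' * ((a + 1) * a))"
      by (simp add: power_mult_distrib mult_ac)
    also have "\<dots> = a\<^sup>2 * b * (b + 1) * (x\<^sup>2 * N)"
      unfolding that(1,2) by (simp add: power2_eq_square mult_ac)
    also have "\<dots> = a\<^sup>2 * b * K * P * (Q * (b + 1))"
      unfolding that(3) by (simp only: mult_ac)
    also have "\<dots> = a * b\<^sup>2 * K * Q' * (P * a)"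
      unfolding that(4) by (simp add: power2_eq_square mult_ac)
    also have "\<dots> = (K * P' * Q') * (b\<^sup>2 * ((a + 1) * a))"
      unfolding that(5)[symmetric] by (simp only: mult_ac)
    finally show ?thesis
      using that by simp
  qed
  show ?case
    unfolding mj(2) by (rule clear_denominators[OF rec bin IH pd pj]) auto
qed

text \<open>
  With weight $|S|^\alpha$, level $2j+1$ contributes the exponent $\alpha - 1$: one power of
  $2j+1$ is lost to $\binom{2m+1}{2j+1} = \frac{2m+1}{2j+1}\binom{2m}{2j}$.
\<close>
definition weighted_convolution :: "real \<Rightarrow> nat \<Rightarrow> real" where
  "weighted_convolution \<alpha> m =
     (\<Sum>j\<le>m. (2 * real j + 1) powr (\<alpha> - 1) * central_prob j * central_prob (m - j))"

lemma fourier_energy_majority: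
  fixes \<alpha> :: real and m :: nat
  defines "n \<equiv> 2 * m + 1"
  shows "(\<Sum>S\<in>Pow {1..n} - {{}}. real (card S) powr \<alpha> *
            (fourier_coeff n (indicator (majority_set n)) S)\<^sup>2)
         = (2 * real m + 1) / 4 * central_prob m * weighted_convolution \<alpha> m"
proof -
  define e where "e t = real (n choose Suc t) * (real (Suc t) powr \<alpha> * (central_coeff m t / 2 ^ n)\<^sup>2)" for t
  have "(\<Sum>S\<in>Pow {1..n} - {{}}. real (card S) powr \<alpha> *
            (fourier_coeff n (indicator (majority_set n)) S)\<^sup>2)
      = (\<Sum>S\<in>Pow {1..n} - {{}}. real (card S) powr \<alpha> * (central_coeff m (card S - 1) / 2 ^ n)\<^sup>2)"
  proof (intro sum.cong refl)
    fix S assume "S \<in> Pow {1..n} - {{}}"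
    then have "fourier_coeff n (indicator (majority_set n)) S = central_coeff m (card S - 1) / 2 ^ n"
      unfolding n_def by (intro fourier_coeff_majority) auto
    then show "real (card S) powr \<alpha> * (fourier_coeff n (indicator (majority_set n)) S)\<^sup>2
        = real (card S) powr \<alpha> * (central_coeff m (card S - 1) / 2 ^ n)\<^sup>2"
      by simp
  qed
  also have "\<dots> = (\<Sum>k\<in>{Suc 0..Suc (2 * m)}. \<Sum>S | S \<in> Pow {1..n} - {{}} \<and> card S = k.
                    real (card S) powr \<alpha> * (central_coeff m (card S - 1) / 2 ^ n)\<^sup>2)"
  proof (rule sum.group[symmetric])
    show "card ` (Pow {1..n} - {{}}) \<subseteq> {Suc 0..Suc (2 * m)}"
    proof (rule image_subsetI)
      fix S assume "S \<in> Pow {1..n} - {{}}"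
      then have S: "S \<subseteq> {1..n}" "S \<noteq> {}" by auto
      then have "finite S" using finite_subset by blast
      then show "card S \<in> {Suc 0..Suc (2 * m)}"
        using S card_mono[OF _ S(1)] card_gt_0_iff[of S] by (auto simp: n_def)
    qed
  qed auto
  also have "\<dots> = (\<Sum>k\<in>{Suc 0..Suc (2 * m)}. e (k - 1))"
  proof (intro sum.cong refl)
    fix k assume k: "k \<in> {Suc 0..Suc (2 * m)}"
    have "{S. S \<in> Pow {1..n} - {{}} \<and> card S = k} = {S. S \<subseteq> {1..n} \<and> card S = k}"
      using k by auto
    then show "(\<Sum>S | S \<in> Pow {1..n} - {{}} \<and> card S = k.
                real (card S) powr \<alpha> * (central_coeff m (card S - 1) / 2 ^ n)\<^sup>2) = e (k - 1)"
      using k n_subsets[of "{1..n}" k] by (simp add: e_def)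
  qed
  also have "\<dots> = (\<Sum>t\<in>{0..2 * m}. e t)"
    by (subst sum.shift_bounds_cl_Suc_ivl) simp
  also have "\<dots> = (\<Sum>t\<in>(\<lambda>j. 2 * j) ` {..m}. e t)"
  proof (rule sum.mono_neutral_right)
    show "\<forall>t\<in>{0..2 * m} - (\<lambda>j. 2 * j) ` {..m}. e t = 0"
    proof
      fix t assume t: "t \<in> {0..2 * m} - (\<lambda>j. 2 * j) ` {..m}"
      have "odd t"
        using t by (auto elim!: evenE)
      then obtain j where "t = 2 * j + 1" by (rule oddE)
      moreover have "2 * j + 1 < 2 * m"
        using t \<open>t = 2 * j + 1\<close> by (cases "2 * j + 1 = 2 * m") (presburger, simp)
      ultimately show "e t = 0"
        using central_coeff_odd[of j m] by (simp add: e_def)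
    qed
  qed auto
  also have "\<dots> = (\<Sum>j\<le>m. e (2 * j))"
    by (subst sum.reindex) (auto simp: inj_on_def)
  also have "\<dots> = (\<Sum>j\<le>m. (2 * real m + 1) / 4 * central_prob m *
      ((2 * real j + 1) powr (\<alpha> - 1) * central_prob j * central_prob (m - j)))"
  proof (intro sum.cong refl)
    fix j assume j: "j \<in> {..m}"
    define w where "w = 2 * real j + 1"
    have w: "w > 0" by (simp add: w_def)
    have "Suc (2 * j) * (n choose Suc (2 * j)) = Suc (2 * m) * (2 * m choose (2 * j))"
      unfolding n_def using Suc_times_binomial[of "2 * j" "2 * m"] by simp
    then have "real (Suc (2 * j)) * real (n choose Suc (2 * j)) = real (Suc (2 * m)) * real (2 * m choose (2 * j))"
      by (metis of_nat_mult)
    then have bin: "real (n choose Suc (2 * j)) = (2 * real m + 1) * real (2 * m choose (2 * j)) / w"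
      using w by (simp add: w_def field_simps)
    have w': "real (Suc (2 * j)) = w" by (simp add: w_def)
    have four: "((2::real) ^ n)\<^sup>2 = 4 * 4 ^ (2 * m)"
      unfolding n_def by (simp add: power_mult power2_eq_square flip: power_mult_distrib)
    have "e (2 * j) = (2 * real m + 1) * (w powr \<alpha> / w) / (4 * 4 ^ (2 * m)) *
           ((central_coeff m (2 * j))\<^sup>2 * real (2 * m choose (2 * j)))"
      unfolding e_def bin w' power_divide four by simp
    also have "\<dots> = (2 * real m + 1) * w powr (\<alpha> - 1) / 4 *
         (central_prob m * central_prob j * central_prob (m - j))"
      using j w by (subst central_coeff_even) (auto simp: powr_diff)
    finally show "e (2 * j) = (2 * real m + 1) / 4 * central_prob m *
      ((2 * real j + 1) powr (\<alpha> - 1) * central_prob j * central_prob (m - j))"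
      by (simp add: w_def)
  qed
  finally show ?thesis
    by (simp add: weighted_convolution_def sum_distrib_left)
qed

section \<open>Size of the weighted convolution\<close>

text \<open>
  The constants $4j+1$ here and $j+1$ below are chosen so that the product with $p_j^2$ is monotone
  in $j$ from the value $1$ at $j = 0$ on.  With $4j+4$ instead of $4j+1$ the product would
  decrease, and the induction for the lower bound would not close.
\<close>
lemma central_prob_square_lower: "1 \<le> (central_prob j)\<^sup>2 * (4 * real j + 1)"
proof (induction j)
  case (Suc j)
  have "(2 * real j + 2)\<^sup>2 * (4 * real j + 1) \<le> (2 * real j + 1)\<^sup>2 * (4 * real j + 5)"
    by (simp add: power2_eq_square algebra_simps)
  then have "(4 * real j + 1) \<le> (2 * real j + 1)\<^sup>2 / (2 * real j + 2)\<^sup>2 * (4 * real j + 5)"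
    by (simp add: field_simps)
  then have "(central_prob j)\<^sup>2 * (4 * real j + 1)
      \<le> (central_prob j)\<^sup>2 * ((2 * real j + 1)\<^sup>2 / (2 * real j + 2)\<^sup>2 * (4 * real j + 5))"
    by (intro mult_left_mono) auto
  also have "\<dots> = (central_prob (Suc j))\<^sup>2 * (4 * real (Suc j) + 1)"
    by (simp add: central_prob_Suc power_mult_distrib power_divide)
  finally show ?case using Suc by linarith
qed simp

lemma central_prob_square_upper: "(central_prob j)\<^sup>2 * (real j + 1) \<le> 1"
proof (induction j)
  case (Suc j)
  have "(2 * real j + 1)\<^sup>2 * (real j + 2) \<le> (2 * real j + 2)\<^sup>2 * (real j + 1)"
    by (simp add: power2_eq_square algebra_simps)
  then have "(2 * real j + 1)\<^sup>2 / (2 * real j + 2)\<^sup>2 * (real j + 2) \<le> real j + 1"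
    by (simp add: field_simps)
  then have "(central_prob j)\<^sup>2 * ((2 * real j + 1)\<^sup>2 / (2 * real j + 2)\<^sup>2 * (real j + 2))
      \<le> (central_prob j)\<^sup>2 * (real j + 1)"
    by (intro mult_left_mono) auto
  also have "(central_prob j)\<^sup>2 * ((2 * real j + 1)\<^sup>2 / (2 * real j + 2)\<^sup>2 * (real j + 2))
      = (central_prob (Suc j))\<^sup>2 * (real (Suc j) + 1)"
    by (simp add: central_prob_Suc power_mult_distrib power_divide)
  finally show ?case using Suc by linarith
qed simp

lemma central_prob_bounds:
  shows central_prob_lower: "1 / 2 * real (Suc j) powr (-1/2) \<le> central_prob j"
    and central_prob_upper: "central_prob j \<le> real (Suc j) powr (-1/2)"
proof -
  have sq: "(real (Suc j) powr (-1/2))\<^sup>2 = 1 / real (Suc j)"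
    by (simp add: power2_eq_square powr_minus_divide flip: powr_add)
  have "(central_prob j)\<^sup>2 * (4 * real j + 1) \<le> (central_prob j)\<^sup>2 * (4 * real (Suc j))"
    by (intro mult_left_mono) auto
  then have "1 \<le> (central_prob j)\<^sup>2 * (4 * real (Suc j))"
    using central_prob_square_lower[of j] by linarith
  then have "(1 / 2 * real (Suc j) powr (-1/2))\<^sup>2 \<le> (central_prob j)\<^sup>2"
    unfolding power_mult_distrib sq by (simp add: power2_eq_square field_simps)
  then show "1 / 2 * real (Suc j) powr (-1/2) \<le> central_prob j"
    using central_prob_pos[of j] by (meson less_imp_le power2_le_imp_le)
  have "(central_prob j)\<^sup>2 \<le> (real (Suc j) powr (-1/2))\<^sup>2"
    unfolding sq using central_prob_square_upper[of j] by (simp add: field_simps)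
  then show "central_prob j \<le> real (Suc j) powr (-1/2)"
    by (rule power2_le_imp_le) simp
qed

definition power_sum :: "real \<Rightarrow> nat \<Rightarrow> real" where
  "power_sum \<beta> M = (\<Sum>i=1..M. real i powr \<beta>)"

lemma power_sum_ge_last_term:
  assumes "\<beta> \<le> 0" "M \<ge> 1"
  shows "real M powr (\<beta> + 1) \<le> power_sum \<beta> M"
proof -
  have "(\<Sum>i=1..M. real M powr \<beta>) \<le> power_sum \<beta> M"
    unfolding power_sum_def using assms by (intro sum_mono powr_mono2') auto
  then show ?thesis
    using assms by (simp add: powr_add mult.commute)
qed

text \<open>
  With $\gamma = \beta + 1 \in (0,1]$, the increment $N^\gamma - (N-1)^\gamma$ is at least
  $\gamma N^{\gamma-1}$ by concavity.  Concavity enters as Bernoulli's inequality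
  $(1 - 1/N)^\gamma \le 1 - \gamma/N$, an instance of Young's inequality with second entry $1$.
\<close>
lemma power_sum_le:
  assumes "-1 < \<beta>" "\<beta> \<le> 0"
  shows "power_sum \<beta> M \<le> real M powr (\<beta> + 1) / (\<beta> + 1)"
proof (induction M)
  case 0
  then show ?case by (simp add: power_sum_def)
next
  case (Suc M)
  show ?case
  proof (cases "M = 0")
    case True
    then show ?thesis using assms by (simp add: power_sum_def)
  next
    case False
    define \<gamma> where "\<gamma> = \<beta> + 1"
    have \<gamma>: "0 < \<gamma>" "\<gamma> \<le> 1" using assms by (auto simp: \<gamma>_def)
    define N where "N = real (Suc M)"
    have N: "N > 1" "real M = N * (1 - 1 / N)" using False by (auto simp: N_def field_simps)
    have "(1 - 1 / N) powr \<gamma> * 1 powr (1 - \<gamma>) \<le> \<gamma> * (1 - 1 / N) + (1 - \<gamma>) * 1"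
      using \<gamma> N by (intro Youngs_inequality_0) auto
    then have bern: "(1 - 1 / N) powr \<gamma> \<le> 1 - \<gamma> / N"
      by (simp add: algebra_simps)
    have "real M powr \<gamma> = N powr \<gamma> * (1 - 1 / N) powr \<gamma>"
      unfolding N(2) by (rule powr_mult)
    also have "\<dots> \<le> N powr \<gamma> * (1 - \<gamma> / N)"
      using bern by (intro mult_left_mono) auto
    also have "\<dots> = N powr \<gamma> - \<gamma> * N powr \<beta>"
    proof -
      have "N powr \<gamma> = N * N powr \<beta>"
        unfolding \<gamma>_def using N(1) by (simp add: powr_add)
      then show ?thesis using N(1) by (simp add: right_diff_distrib)
    qed
    finally have "(real M powr \<gamma> + \<gamma> * N powr \<beta>) / \<gamma> \<le> N powr \<gamma> / \<gamma>"
      using \<gamma> by (intro divide_right_mono) auto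
    then have "real M powr \<gamma> / \<gamma> + N powr \<beta> \<le> N powr \<gamma> / \<gamma>"
      using \<gamma> by (simp add: add_divide_distrib)
    then show ?thesis
      using Suc by (simp add: power_sum_def \<gamma>_def N_def)
  qed
qed

text \<open>
  Every factor $p_{m-j}$ is at least of the order $(m+1)^{-1/2}$, so it can be pulled out of the sum.
  The constant collects a factor $1/2$ from each of the two return probabilities and one
  from $2j+1 \le 2(j+1)$.
\<close>
lemma weighted_convolution_lower:
  assumes "0 < \<alpha>" "\<alpha> < 1"
  shows "1 / 8 * real (Suc m) powr (-1/2) * power_sum (\<alpha> - 3/2) (Suc m) \<le> weighted_convolution \<alpha> m"
proof -
  have "1 / 8 * real (Suc m) powr (-1/2) * power_sum (\<alpha> - 3/2) (Suc m)
      = (\<Sum>j\<le>m. 1 / 8 * real (Suc m) powr (-1/2) * real (Suc j) powr (\<alpha> - 3/2))"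
    unfolding power_sum_def One_nat_def sum.shift_bounds_cl_Suc_ivl
    by (simp add: sum_distrib_left atMost_atLeast0 del: of_nat_Suc)
  also have "\<dots> \<le> weighted_convolution \<alpha> m"
    unfolding weighted_convolution_def
  proof (intro sum_mono)
    fix j assume j: "j \<in> {..m}"
    have "(1/2) powr 1 \<le> (1/2 :: real) powr (1 - \<alpha>)"
      using assms by (intro powr_mono') auto
    then have "1 / 2 * real (Suc j) powr (\<alpha> - 1) \<le> (1/2) powr (1 - \<alpha>) * real (Suc j) powr (\<alpha> - 1)"
      by (intro mult_right_mono) auto
    also have "\<dots> = (2 * real (Suc j)) powr (\<alpha> - 1)"
      by (subst powr_mult) (auto simp: powr_divide powr_diff)
    also have "\<dots> \<le> (2 * real j + 1) powr (\<alpha> - 1)"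
      using assms by (intro powr_mono2') auto
    finally have 1: "1 / 2 * real (Suc j) powr (\<alpha> - 1) \<le> (2 * real j + 1) powr (\<alpha> - 1)" .
    have "1 / 2 * real (Suc m) powr (-1/2) \<le> 1 / 2 * real (Suc (m - j)) powr (-1/2)"
      by (intro mult_left_mono powr_mono2') auto
    then have 2: "1 / 2 * real (Suc m) powr (-1/2) \<le> central_prob (m - j)"
      using central_prob_lower[of "m - j"] by linarith
    have "1 / 8 * real (Suc m) powr (-1/2) * real (Suc j) powr (\<alpha> - 3/2)
       = (1 / 2 * real (Suc j) powr (\<alpha> - 1)) * (1 / 2 * real (Suc j) powr (-1/2))
           * (1 / 2 * real (Suc m) powr (-1/2))"
      by (simp add: mult_ac flip: powr_add del: of_nat_Suc)
    also have "\<dots> \<le> (2 * real j + 1) powr (\<alpha> - 1) * central_prob j * central_prob (m - j)"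
      using central_prob_pos by (intro mult_mono 1 2 central_prob_lower mult_nonneg_nonneg less_imp_le[OF central_prob_pos]) auto
    finally show "1 / 8 * real (Suc m) powr (-1/2) * real (Suc j) powr (\<alpha> - 3/2)
       \<le> (2 * real j + 1) powr (\<alpha> - 1) * central_prob j * central_prob (m - j)" .
  qed
  finally show ?thesis .
qed

text \<open>
  For $i = j+1 \le M/2$ the factor $(m-j+1)^{-1/2}$ is at most $2M^{-1/2}$.  For $i > M/2$ the factor
  $i^{\alpha-3/2}$ is at most $4M^{\alpha-3/2}$, and the remaining sum of $l^{-1/2}$ is at most
  $2M^{1/2}$.  The second part is then at most $8M^{-1/2}M^{\alpha-1/2}$, which the power sum
  dominates since each of its $M$ terms is at least the last one.  The constant $10 = 2 + 8$ is
  thus the same for all $\alpha$.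
\<close>
lemma weighted_convolution_upper:
  assumes "0 < \<alpha>" "\<alpha> < 1"
  shows "weighted_convolution \<alpha> m \<le> 10 * real (Suc m) powr (-1/2) * power_sum (\<alpha> - 3/2) (Suc m)"
proof -
  define M where "M = Suc m"
  define h where "h i = real i powr (-1/2)" for i :: nat
  define u where "u i = real i powr (\<alpha> - 3/2)" for i :: nat
  have M0: "real M > 0" by (simp add: M_def)
  have split: "u (Suc j) * h (Suc (m - j)) \<le> 2 * h M * u (Suc j) + 4 * real M powr (\<alpha> - 3/2) * h (Suc (m - j))"
    if j: "j \<le> m" for j
  proof (cases "2 * Suc j \<le> M")
    case True
    have "h (Suc (m - j)) \<le> (real M / 2) powr (-1/2)"
      unfolding h_def using True j M0 by (intro powr_mono2') (auto simp: M_def)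
    also have "\<dots> = (1/2) powr (-1/2) * h M"
      using M0 by (simp add: h_def powr_divide)
    also have "\<dots> \<le> 2 * h M"
    proof (intro mult_right_mono)
      have "(1/2) powr (-1/2) \<le> (1/2::real) powr (-1)" by (intro powr_mono') auto
      then show "(1/2) powr (-1/2) \<le> (2::real)" by (simp add: powr_minus)
    qed (simp add: h_def)
    finally have "u (Suc j) * h (Suc (m - j)) \<le> u (Suc j) * (2 * h M)"
      by (intro mult_left_mono) (auto simp: u_def)
    then have "u (Suc j) * h (Suc (m - j)) \<le> 2 * h M * u (Suc j)"
      by (simp only: mult_ac)
    moreover have "0 \<le> 4 * real M powr (\<alpha> - 3/2) * h (Suc (m - j))" by (simp add: h_def)
    ultimately show ?thesis by linarith
  next
    case False
    have "u (Suc j) \<le> (real M / 2) powr (\<alpha> - 3/2)"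
      unfolding u_def using False assms M0 by (intro powr_mono2') (auto simp: M_def)
    also have "\<dots> = (1/2) powr (\<alpha> - 3/2) * real M powr (\<alpha> - 3/2)"
      using M0 by (simp add: powr_divide)
    also have "\<dots> \<le> 4 * real M powr (\<alpha> - 3/2)"
    proof (intro mult_right_mono)
      have "(1/2) powr (\<alpha> - 3/2) \<le> (1/2::real) powr (-2)" using assms by (intro powr_mono') auto
      then show "(1/2) powr (\<alpha> - 3/2) \<le> (4::real)" by (simp add: powr_minus power2_eq_square)
    qed simp
    finally have "u (Suc j) * h (Suc (m - j)) \<le> 4 * real M powr (\<alpha> - 3/2) * h (Suc (m - j))"
      by (intro mult_right_mono) (auto simp: h_def)
    moreover have "0 \<le> 2 * h M * u (Suc j)" by (simp add: h_def u_def)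
    ultimately show ?thesis by linarith
  qed
  have U: "(\<Sum>j\<le>m. u (Suc j)) = power_sum (\<alpha> - 3/2) M"
    unfolding power_sum_def M_def One_nat_def sum.shift_bounds_cl_Suc_ivl u_def
    by (simp add: atMost_atLeast0)
  have "(\<Sum>j\<le>m. h (Suc (m - j))) = (\<Sum>j\<le>m. h (Suc j))"
    using sum.nat_diff_reindex[of "\<lambda>j. h (Suc j)" "Suc m"] by (simp add: lessThan_Suc_atMost)
  also have "\<dots> = power_sum (-1/2) M"
    unfolding power_sum_def M_def One_nat_def sum.shift_bounds_cl_Suc_ivl h_def
    by (simp add: atMost_atLeast0)
  also have "\<dots> \<le> 2 * real M powr (1/2)"
    using power_sum_le[of "-1/2" M] by simp
  finally have H: "(\<Sum>j\<le>m. h (Suc (m - j))) \<le> 2 * real M powr (1/2)" .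
  have "weighted_convolution \<alpha> m \<le> (\<Sum>j\<le>m. u (Suc j) * h (Suc (m - j)))"
    unfolding weighted_convolution_def
  proof (intro sum_mono)
    fix j assume "j \<in> {..m}"
    have "(2 * real j + 1) powr (\<alpha> - 1) \<le> real (Suc j) powr (\<alpha> - 1)"
      using assms by (intro powr_mono2') auto
    then have "(2 * real j + 1) powr (\<alpha> - 1) * central_prob j * central_prob (m - j)
        \<le> real (Suc j) powr (\<alpha> - 1) * real (Suc j) powr (-1/2) * h (Suc (m - j))"
      unfolding h_def
      by (intro mult_mono central_prob_upper mult_nonneg_nonneg less_imp_le[OF central_prob_pos]) auto
    then show "(2 * real j + 1) powr (\<alpha> - 1) * central_prob j * central_prob (m - j)
        \<le> u (Suc j) * h (Suc (m - j))"
      by (simp add: u_def flip: powr_add)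
  qed
  also have "\<dots> \<le> (\<Sum>j\<le>m. 2 * h M * u (Suc j) + 4 * real M powr (\<alpha> - 3/2) * h (Suc (m - j)))"
    using split by (intro sum_mono) auto
  also have "\<dots> = 2 * h M * power_sum (\<alpha> - 3/2) M
      + 4 * real M powr (\<alpha> - 3/2) * (\<Sum>j\<le>m. h (Suc (m - j)))"
    by (simp add: sum.distrib U flip: sum_distrib_left)
  also have "4 * real M powr (\<alpha> - 3/2) * (\<Sum>j\<le>m. h (Suc (m - j)))
      \<le> 4 * real M powr (\<alpha> - 3/2) * (2 * real M powr (1/2))"
    by (intro mult_left_mono H) auto
  also have "\<dots> = 8 * h M * real M powr (\<alpha> - 3/2 + 1)"
    by (simp add: h_def flip: powr_add)
  also have "\<dots> \<le> 8 * h M * power_sum (\<alpha> - 3/2) M"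
    using assms by (intro mult_left_mono power_sum_ge_last_term) (auto simp: h_def M_def)
  finally show ?thesis
    by (simp add: h_def M_def)
qed

section \<open>The three regimes of the power sum\<close>

text \<open>
  This includes $k = 0$, where the factor $\sqrt k$ vanishes; the second half of the theorem is
  therefore the case $\alpha = 1/2$ of the first.
\<close>
lemma omega_half: "omega (1/2) k = sqrt (real k) * ln (exp 1 + real k)"
  by (simp add: omega_def)

lemma harmonic_comparable_log:
  assumes "M \<ge> 1"
  shows "1 / 3 * ln (exp 1 + real M) \<le> power_sum (-1) M"
    and "power_sum (-1) M \<le> 2 * ln (exp 1 + real M)"
proof -
  have harm: "power_sum (-1) M = harm M"
    unfolding power_sum_def harm_def by (intro sum.cong) (auto simp: powr_minus)
  \<comment> \<open>The cube absorbs the summand $e \<le> 3$ inside the logarithm, uniformly from $M = 1$ on.\<close>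
  have "real M * 2 \<ge> 2" "real M * (real M * real M) \<ge> 0" "real M * (real M * 3) \<ge> 0"
    using assms by auto
  moreover have "(real M + 1) ^ 3
      = 1 + real M + real M * 2 + real M * (real M * real M) + real M * (real M * 3)"
    by (simp add: power3_eq_cube algebra_simps)
  ultimately have "exp 1 + real M \<le> (real M + 1) ^ 3"
    using exp_le by linarith
  then have "ln (exp 1 + real M) \<le> ln ((real M + 1) ^ 3)"
    by (subst ln_le_cancel_iff) (auto intro: add_pos_nonneg)
  also have "\<dots> = 3 * ln (real M + 1)"
    by (subst ln_realpow) auto
  also have "ln (real M + 1) \<le> harm M"
    using ln_le_harm[of M] by simp
  finally show "1 / 3 * ln (exp 1 + real M) \<le> power_sum (-1) M"
    by (simp add: harm)
  have "harm M \<le> ln (real M) + 1"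
    using euler_mascheroni_sequence_decreasing[of 1 M] assms by (simp add: harm_def)
  moreover have "ln (real M) \<le> ln (exp 1 + real M)"
    using assms by (subst ln_le_cancel_iff) (auto intro: add_pos_nonneg)
  moreover have "ln (exp 1) \<le> ln (exp 1 + real M)"
    by (subst ln_le_cancel_iff) (auto intro: add_pos_nonneg)
  ultimately show "power_sum (-1) M \<le> 2 * ln (exp 1 + real M)"
    by (simp add: harm)
qed

text \<open>
  The exponent $\alpha - 3/2$ lies below, at or above $-1$ according as $\alpha$ lies below, at or
  above $1/2$.  Accordingly the power sum is bounded, logarithmic, or of order $M^{\alpha-1/2}$.
\<close>
lemma omega_comparable_power_sum:
  assumes "0 < \<alpha>" "\<alpha> < 1"
  obtains a b where "0 < a" "0 < b"
    "\<And>M. M \<ge> 1 \<Longrightarrow> a * omega \<alpha> M \<le> sqrt (real M) * power_sum (\<alpha> - 3/2) M"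
    "\<And>M. M \<ge> 1 \<Longrightarrow> sqrt (real M) * power_sum (\<alpha> - 3/2) M \<le> b * omega \<alpha> M"
proof -
  consider "\<alpha> < 1/2" | "\<alpha> = 1/2" | "\<alpha> > 1/2" by linarith
  then show thesis
  proof cases
    case 1
    let ?f = "\<lambda>i::nat. real i powr (\<alpha> - 3/2)"
    have summ: "summable ?f"
      using 1 by (subst summable_real_powr_iff) auto
    have upper: "power_sum (\<alpha> - 3/2) M \<le> suminf ?f" for M
      unfolding power_sum_def using summ by (intro sum_le_suminf) auto
    have lower: "1 \<le> power_sum (\<alpha> - 3/2) M" if "M \<ge> 1" for M
    proof -
      have "(\<Sum>i\<in>{1}. ?f i) \<le> power_sum (\<alpha> - 3/2) M"
        unfolding power_sum_def using that by (intro sum_mono2) auto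
      then show ?thesis by simp
    qed
    have pos: "suminf ?f > 0"
      using lower[of 1] upper[of 1] by simp
    show thesis
      using that[of 1 "suminf ?f"] pos 1 lower upper by (auto simp: omega_def mult.commute mult_left_mono)
  next
    case 2
    have eq: "sqrt (real M) * power_sum (\<alpha> - 3/2) M = sqrt (real M) * power_sum (-1) M" for M
    proof -
      have "\<alpha> - 3 / 2 = -1" using 2 by simp
      then show ?thesis by (simp only:)
    qed
    show thesis
    proof (rule that[of "1/3" 2])
      fix M :: nat assume M: "M \<ge> 1"
      show "1 / 3 * omega \<alpha> M \<le> sqrt (real M) * power_sum (\<alpha> - 3/2) M"
        unfolding eq 2 omega_half using mult_left_mono[OF harmonic_comparable_log(1)[OF M], of "sqrt (real M)"]
        by (simp add: mult_ac)
      show "sqrt (real M) * power_sum (\<alpha> - 3/2) M \<le> 2 * omega \<alpha> M"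
        unfolding eq 2 omega_half using mult_left_mono[OF harmonic_comparable_log(2)[OF M], of "sqrt (real M)"]
        by (simp add: mult_ac)
    qed auto
  next
    case 3
    have om: "omega \<alpha> M = sqrt (real M) * real M powr (\<alpha> - 3/2 + 1)" if "M \<ge> 1" for M
      using that 3 by (simp add: omega_def powr_half_sqrt[symmetric] flip: powr_add)
    show thesis
    proof (rule that[of 1 "1 / (\<alpha> - 1/2)"])
      fix M :: nat assume M: "M \<ge> 1"
      show "1 * omega \<alpha> M \<le> sqrt (real M) * power_sum (\<alpha> - 3/2) M"
        unfolding om[OF M] mult_1 using assms M by (intro mult_left_mono power_sum_ge_last_term) auto
      have "sqrt (real M) * power_sum (\<alpha> - 3/2) M
          \<le> sqrt (real M) * (real M powr (\<alpha> - 3/2 + 1) / (\<alpha> - 3/2 + 1))"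
        using assms 3 by (intro mult_left_mono power_sum_le) auto
      also have "\<dots> = 1 / (\<alpha> - 1/2) * omega \<alpha> M"
        unfolding om[OF M] by simp
      finally show "sqrt (real M) * power_sum (\<alpha> - 3/2) M \<le> 1 / (\<alpha> - 1/2) * omega \<alpha> M" .
    qed (use 3 in auto)
  qed
qed

section \<open>Comparison for majority\<close>

text \<open>
  After division by the common factor $K = \frac{2m+1}{2M}\,p_m$, the two sides are $\omega_\alpha(M)$
  and $\frac M2$ times the weighted convolution.
\<close>
lemma majority_energy_comparable:
  fixes \<alpha> :: real
  assumes \<alpha>: "0 < \<alpha>" "\<alpha> < 1"
  shows "\<exists>c C::real. 0 < c \<and> c \<le> C \<and>
        (\<forall>n::nat. odd n \<and> n \<ge> 3 \<longrightarrow>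
          c * cube_expectation n (\<lambda>x. omega \<alpha> (sens n (majority_set n) x))
            \<le> (\<Sum>S\<in>Pow {1..n} - {{}}. real (card S) powr \<alpha> *
                  (fourier_coeff n (indicator (majority_set n)) S)\<^sup>2) \<and>
          (\<Sum>S\<in>Pow {1..n} - {{}}. real (card S) powr \<alpha> *
                  (fourier_coeff n (indicator (majority_set n)) S)\<^sup>2)
            \<le> C * cube_expectation n (\<lambda>x. omega \<alpha> (sens n (majority_set n) x)))"
proof -
  obtain a b where ab: "0 < a" "0 < b"
    and lower: "\<And>M. M \<ge> 1 \<Longrightarrow> a * omega \<alpha> M \<le> sqrt (real M) * power_sum (\<alpha> - 3/2) M"
    and upper: "\<And>M. M \<ge> 1 \<Longrightarrow> sqrt (real M) * power_sum (\<alpha> - 3/2) M \<le> b * omega \<alpha> M"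
    using omega_comparable_power_sum[OF \<alpha>] by blast
  show ?thesis
  proof (rule exI[of _ "a / 16"], rule exI[of _ "max (a / 16) (5 * b)"], intro conjI allI impI)
    fix n :: nat assume "odd n \<and> n \<ge> 3"
    then obtain m where n: "n = 2 * m + 1" by (elim conjE oddE)
    define M where "M = Suc m"
    define T where "T = power_sum (\<alpha> - 3/2) M"
    define E where "E = cube_expectation n (\<lambda>x. omega \<alpha> (sens n (majority_set n) x))"
    define W where "W = (\<Sum>S\<in>Pow {1..n} - {{}}. real (card S) powr \<alpha> *
                  (fourier_coeff n (indicator (majority_set n)) S)\<^sup>2)"
    define K where "K = (2 * real m + 1) / (2 * real M) * central_prob m"
    have K: "K > 0" using central_prob_pos[of m] by (simp add: K_def M_def)
    have M: "M \<ge> 1" by (simp add: M_def)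
    have E: "E = K * omega \<alpha> M"
      unfolding E_def n K_def M_def
      by (subst expectation_sens_majority) (simp_all add: omega_def algebra_simps)
    have W: "W = K * (real M / 2 * weighted_convolution \<alpha> m)"
      unfolding W_def n fourier_energy_majority K_def using M by simp
    have scale: "real M * real M powr (-1/2) = sqrt (real M)"
    proof -
      have "real M * real M powr (-1/2) = real M powr (1 + (-1/2))"
        using M by (subst powr_add) simp
      then show ?thesis using M by (simp add: powr_half_sqrt)
    qed
    have T_scaled: "real M / 2 * (c * real M powr (-1/2) * T) = c / 2 * (sqrt (real M) * T)" for c
      by (simp add: mult_ac flip: scale)
    have "real M / 2 * (1 / 8 * real M powr (-1/2) * T) \<le> real M / 2 * weighted_convolution \<alpha> m"
      unfolding T_def M_def by (intro mult_left_mono weighted_convolution_lower \<alpha>) auto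
    then have "a / 16 * omega \<alpha> M \<le> real M / 2 * weighted_convolution \<alpha> m"
      unfolding T_scaled using lower[OF M] by (simp add: T_def)
    then have "K * (a / 16 * omega \<alpha> M) \<le> W"
      unfolding W using K by (intro mult_left_mono) auto
    then show "a / 16 * E \<le> W"
      unfolding E by (simp add: mult_ac)
    have "real M / 2 * weighted_convolution \<alpha> m \<le> real M / 2 * (10 * real M powr (-1/2) * T)"
      unfolding T_def M_def by (intro mult_left_mono weighted_convolution_upper \<alpha>) auto
    then have "real M / 2 * weighted_convolution \<alpha> m \<le> 5 * b * omega \<alpha> M"
      unfolding T_scaled using upper[OF M] by (simp add: T_def)
    then have "W \<le> K * (5 * b * omega \<alpha> M)"
      unfolding W using K by (intro mult_left_mono) auto
    then have "W \<le> 5 * b * E"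
      unfolding E by (simp add: mult_ac)
    also have "\<dots> \<le> max (a / 16) (5 * b) * E"
    proof (intro mult_right_mono)
      have "omega \<alpha> M \<ge> 0" by (auto simp: omega_def intro!: mult_nonneg_nonneg ln_ge_zero add_increasing2)
      then show "E \<ge> 0" using K by (simp add: E)
    qed simp
    finally show "W \<le> max (a / 16) (5 * b) * E" .
  qed (use ab in auto)
qed

theorem proposition6p8:
  shows "(\<forall>\<alpha>::real. 0 < \<alpha> \<and> \<alpha> < 1 \<longrightarrow>
      (\<exists>c C::real. 0 < c \<and> c \<le> C \<and>
        (\<forall>n::nat. odd n \<and> n \<ge> 3 \<longrightarrow>
          c * cube_expectation n (\<lambda>x. omega \<alpha> (sens n (majority_set n) x))
            \<le> (\<Sum>S\<in>Pow {1..n} - {{}}. real (card S) powr \<alpha> *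
                  (fourier_coeff n (indicator (majority_set n)) S)\<^sup>2) \<and>
          (\<Sum>S\<in>Pow {1..n} - {{}}. real (card S) powr \<alpha> *
                  (fourier_coeff n (indicator (majority_set n)) S)\<^sup>2)
            \<le> C * cube_expectation n (\<lambda>x. omega \<alpha> (sens n (majority_set n) x)))))
    \<and> (\<exists>c C::real. 0 < c \<and> c \<le> C \<and>
        (\<forall>n::nat. odd n \<and> n \<ge> 3 \<longrightarrow>
          c * cube_expectation n (\<lambda>x. sqrt (real (sens n (majority_set n) x)) *
                  ln (exp 1 + real (sens n (majority_set n) x)))
            \<le> (\<Sum>S\<in>Pow {1..n} - {{}}. sqrt (real (card S)) *
                  (fourier_coeff n (indicator (majority_set n)) S)\<^sup>2) \<and>
          (\<Sum>S\<in>Pow {1..n} - {{}}. sqrt (real (card S)) *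
                  (fourier_coeff n (indicator (majority_set n)) S)\<^sup>2)
            \<le> C * cube_expectation n (\<lambda>x. sqrt (real (sens n (majority_set n) x)) *
                  ln (exp 1 + real (sens n (majority_set n) x)))))"
proof (intro conjI allI impI)
  fix \<alpha> :: real assume "0 < \<alpha> \<and> \<alpha> < 1"
  then show "\<exists>c C::real. 0 < c \<and> c \<le> C \<and>
        (\<forall>n::nat. odd n \<and> n \<ge> 3 \<longrightarrow>
          c * cube_expectation n (\<lambda>x. omega \<alpha> (sens n (majority_set n) x))
            \<le> (\<Sum>S\<in>Pow {1..n} - {{}}. real (card S) powr \<alpha> *
                  (fourier_coeff n (indicator (majority_set n)) S)\<^sup>2) \<and>
          (\<Sum>S\<in>Pow {1..n} - {{}}. real (card S) powr \<alpha> *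
                  (fourier_coeff n (indicator (majority_set n)) S)\<^sup>2)
            \<le> C * cube_expectation n (\<lambda>x. omega \<alpha> (sens n (majority_set n) x)))"
    by (intro majority_energy_comparable) auto
qed (use majority_energy_comparable[of "1/2"] in \<open>simp add: omega_half powr_half_sqrt\<close>)

end
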